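(* Let $n$ and $k$ be integers with $1 \leq k < n/2$. (i) If $n$ is odd, then $\mathrm{GP}(n,k)$ is stable. (ii) $\mathrm{GP}(n,k)$ is trivially unstable if and only if $n$ is even and $k$ is odd. (iii) If both $n$ and $k$ are even, then $\mathrm{GP}(n,k)$ is nontrivially unstable if and only if $k^2\equiv\pm 1 \pmod{n/2}$ or $n=4k$.
   Context: For integers $n,k$ with $1\le k<n/2$, the generalized Petersen graph $\mathrm{GP}(n,k)$ is the graph with vertices $u_0,\dots,u_{n-1},v_0,\dots,v_{n-1}$ and edges $\{u_i,u_{i+1}\}$, $\{u_i,v_i\}$, $\{v_i,v_{i+k}\}$ for $i\in\{0,\dots,n-1\}$, subscripts taken modulo $n$. The canonical double cover $D(\Gamma)$ of a graph $\Gamma$ is the direct product $\Gamma\times K_2$: its vertex set is $V(\Gamma)\times\mathbb{Z}_2$, and $(u,x)$, $(v,y)$ are adjacent iff $u,v$ are adjacent in $\Gamma$ and $x\neq y$. One always has $\mathrm{Aut}(D(\Gamma))\geq \mathrm{Aut}(\Gamma)\times\mathbb{Z}_2$ (automorphisms of $\Gamma$ acting on the first coordinate, and the swap of the second coordinate). $\Gamma$ is called stable if $\mathrm{Aut}(D(\Gamma))=\mathrm{Aut}(\Gamma)\times\mathbb{Z}_2$, and unstable otherwise. A graph is vertex-determining if no two distinct vertices have the same neighbourhood. An unstable graph is nontrivially unstable if it is connected, non-bipartite and vertex-determining, and trivially unstable otherwise. *)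

theory Defs
  imports "HOL-Number_Theory.Cong"
begin

text \<open>A (simple) graph is given by a vertex set V and a symmetric adjacency
relation E; only adjacency between vertices of V is relevant.\<close>

text \<open>Automorphisms: adjacency-preserving bijections of V, extended by the identity
outside V (so that the automorphism group is a genuine set of functions).\<close>
definition aut :: "'a set \<Rightarrow> ('a \<Rightarrow> 'a \<Rightarrow> bool) \<Rightarrow> ('a \<Rightarrow> 'a) set" where
  "aut V E = {f. bij_betw f V V \<and> (\<forall>u\<in>V. \<forall>v\<in>V. E u v \<longleftrightarrow> E (f u) (f v))
                 \<and> (\<forall>x. x \<notin> V \<longrightarrow> f x = x)}"

definition dc_V :: "'a set \<Rightarrow> ('a \<times> bool) set" where
  "dc_V V = V \<times> (UNIV :: bool set)"

definition dc_E :: "('a \<Rightarrow> 'a \<Rightarrow> bool) \<Rightarrow> ('a \<times> bool) \<Rightarrow> ('a \<times> bool) \<Rightarrow> bool" where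
  "dc_E E p q = (E (fst p) (fst q) \<and> snd p \<noteq> snd q)"

text \<open>The copy of Aut(Gamma) x Z2 inside Aut(D(Gamma)): sigma acting on the first
coordinate, s = True swapping the second coordinate.\<close>
definition lift :: "'a set \<Rightarrow> ('a \<Rightarrow> 'a) \<Rightarrow> bool \<Rightarrow> ('a \<times> bool \<Rightarrow> 'a \<times> bool)" where
  "lift V \<sigma> s = (\<lambda>(v, x). if v \<in> V then (\<sigma> v, x \<noteq> s) else (v, x))"

definition stable :: "'a set \<Rightarrow> ('a \<Rightarrow> 'a \<Rightarrow> bool) \<Rightarrow> bool" where
  "stable V E \<longleftrightarrow> aut (dc_V V) (dc_E E) = {lift V \<sigma> s | \<sigma> s. \<sigma> \<in> aut V E}"

definition unstable :: "'a set \<Rightarrow> ('a \<Rightarrow> 'a \<Rightarrow> bool) \<Rightarrow> bool" where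
  "unstable V E \<longleftrightarrow> \<not> stable V E"

definition connected_graph :: "'a set \<Rightarrow> ('a \<Rightarrow> 'a \<Rightarrow> bool) \<Rightarrow> bool" where
  "connected_graph V E \<longleftrightarrow>
     (\<forall>u\<in>V. \<forall>v\<in>V. (\<lambda>a b. a \<in> V \<and> b \<in> V \<and> E a b)\<^sup>*\<^sup>* u v)"

definition bipartite :: "'a set \<Rightarrow> ('a \<Rightarrow> 'a \<Rightarrow> bool) \<Rightarrow> bool" where
  "bipartite V E \<longleftrightarrow>
     (\<exists>A. A \<subseteq> V \<and> (\<forall>u\<in>V. \<forall>v\<in>V. E u v \<longrightarrow> (u \<in> A \<longleftrightarrow> v \<notin> A)))"

definition nbhd :: "'a set \<Rightarrow> ('a \<Rightarrow> 'a \<Rightarrow> bool) \<Rightarrow> 'a \<Rightarrow> 'a set" where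
  "nbhd V E u = {w \<in> V. E u w}"

definition vertex_determining :: "'a set \<Rightarrow> ('a \<Rightarrow> 'a \<Rightarrow> bool) \<Rightarrow> bool" where
  "vertex_determining V E \<longleftrightarrow> (\<forall>u\<in>V. \<forall>v\<in>V. u \<noteq> v \<longrightarrow> nbhd V E u \<noteq> nbhd V E v)"

definition nontrivially_unstable :: "'a set \<Rightarrow> ('a \<Rightarrow> 'a \<Rightarrow> bool) \<Rightarrow> bool" where
  "nontrivially_unstable V E \<longleftrightarrow> unstable V E \<and> connected_graph V E \<and>
     \<not> bipartite V E \<and> vertex_determining V E"

definition trivially_unstable :: "'a set \<Rightarrow> ('a \<Rightarrow> 'a \<Rightarrow> bool) \<Rightarrow> bool" where
  "trivially_unstable V E \<longleftrightarrow> unstable V E \<and>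
     \<not> (connected_graph V E \<and> \<not> bipartite V E \<and> vertex_determining V E)"

text \<open>Generalized Petersen graph GP(n,k): u_i = (False, i), v_i = (True, i), i < n.\<close>
definition gp_V :: "nat \<Rightarrow> (bool \<times> nat) set" where
  "gp_V n = {(b, i). i < n}"

definition gp_E :: "nat \<Rightarrow> nat \<Rightarrow> (bool \<times> nat) \<Rightarrow> (bool \<times> nat) \<Rightarrow> bool" where
  "gp_E n k a b \<longleftrightarrow> snd a < n \<and> snd b < n \<and>
     ((\<not> fst a \<and> \<not> fst b \<and> (snd b = (snd a + 1) mod n \<or> snd a = (snd b + 1) mod n))
      \<or> (fst a \<noteq> fst b \<and> snd a = snd b)
      \<or> (fst a \<and> fst b \<and> (snd b = (snd a + k) mod n \<or> snd a = (snd b + k) mod n)))"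

end

theory Submission
  imports Defs
begin

text \<open>A connected graph is stable if and only if every automorphism of its double cover commutes with the
swap of the two copies. In the double cover of \<open>GP(n,k)\<close>, the numbers of cyclically reduced closed
8-walks through an outer edge, a spoke and an inner edge are explicit sums over the congruences
\<open>p + q k \<equiv> 0 (mod n)\<close> that hold. Unless the three numbers agree, every automorphism preserves the spokes,
since the spokes are then distinguished by the counts at their ends. They agree only for
nine pairs \<open>(n,k)\<close> with \<open>n \<le> 26\<close>; of these only \<open>(5,2)\<close> and \<open>(13,5)\<close> matter, and there the swap maps each
vertex to the unique vertex at maximal distance.

An automorphism preserving the spokes permutes the cycles formed by the other edges. If \<open>n\<close> is odd, the
swap is the antipodal map of each of these cycles, so it is central. If \<open>n\<close> and \<open>k\<close> are even, the swap is
a detour along spoke, inner edge, spoke and \<open>k\<close> outer edges; following such detours in both directions shows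
that it is central unless \<open>n = 4 k\<close> or \<open>k\<^sup>2 \<equiv> \<plusminus>1 (mod n/2)\<close>. In these cases, and for \<open>n\<close> even and \<open>k\<close> odd,
explicit automorphisms do not commute with the swap.\<close>

section \<open>Automorphisms of canonical double covers\<close>

lemma aut_bij: "f \<in> aut V E \<Longrightarrow> bij_betw f V V"
  by (simp add: aut_def)

lemma aut_mem: "f \<in> aut V E \<Longrightarrow> v \<in> V \<Longrightarrow> f v \<in> V"
  using aut_bij bij_betwE by blast

lemma aut_adj: "f \<in> aut V E \<Longrightarrow> u \<in> V \<Longrightarrow> v \<in> V \<Longrightarrow> E (f u) (f v) \<longleftrightarrow> E u v"
  unfolding aut_def by blast

lemma aut_inj: "f \<in> aut V E \<Longrightarrow> u \<in> V \<Longrightarrow> v \<in> V \<Longrightarrow> f u = f v \<longleftrightarrow> u = v"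
  using inj_on_eq_iff[OF bij_betw_imp_inj_on[OF aut_bij]] .

lemma aut_out: "f \<in> aut V E \<Longrightarrow> v \<notin> V \<Longrightarrow> f v = v"
  by (simp add: aut_def)

lemma aut_nbhd:
  assumes "f \<in> aut V E" "v \<in> V"
  shows "nbhd V E (f v) = f ` nbhd V E v"
proof -
  have "f ` V = V"
    using aut_bij[OF assms(1)] by (simp add: bij_betw_def)
  then have "nbhd V E (f v) = {w \<in> f ` V. E (f v) w}"
    by (simp add: nbhd_def)
  also have "\<dots> = f ` {w \<in> V. E v w}"
    using aut_adj[OF assms] by (auto simp: image_iff)
  finally show ?thesis
    by (simp add: nbhd_def)
qed

text \<open>On a finite graph an injective homomorphism permutes the arcs, so it also reflects adjacency.\<close>
lemma finite_hom_in_aut: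
  assumes "finite V" and inj: "inj_on f V" and mem: "\<And>v. v \<in> V \<Longrightarrow> f v \<in> V"
    and hom: "\<And>u v. u \<in> V \<Longrightarrow> v \<in> V \<Longrightarrow> E u v \<Longrightarrow> E (f u) (f v)"
    and out: "\<And>v. v \<notin> V \<Longrightarrow> f v = v"
  shows "f \<in> aut V E"
proof -
  have surj: "f ` V = V"
    using assms(1) inj mem by (simp add: endo_inj_surj image_subsetI)
  define P where "P = {(u, v). u \<in> V \<and> v \<in> V \<and> E u v}"
  have "finite P"
    by (rule finite_subset[of _ "V \<times> V"]) (auto simp: P_def assms(1))
  moreover have "map_prod f f ` P \<subseteq> P"
    using mem hom by (auto simp: P_def)
  moreover have "inj_on (map_prod f f) P"
    using inj by (auto simp: P_def inj_on_def)
  ultimately have P: "map_prod f f ` P = P"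
    by (simp add: endo_inj_surj)
  have "E u v" if "u \<in> V" "v \<in> V" "E (f u) (f v)" for u v
  proof -
    have "(f u, f v) \<in> map_prod f f ` P"
      using that mem P by (simp add: P_def)
    then obtain u' v' where "u' \<in> V" "v' \<in> V" "E u' v'" "f u = f u'" "f v = f v'"
      by (auto simp: P_def)
    then show ?thesis
      using inj that by (metis inj_onD)
  qed
  then have "\<forall>u\<in>V. \<forall>v\<in>V. E u v \<longleftrightarrow> E (f u) (f v)"
    using hom by blast
  then show ?thesis
    using surj inj out by (simp add: aut_def bij_betw_def)
qed

lemma lift_in_aut:
  assumes "\<sigma> \<in> aut V E"
  shows "lift V \<sigma> s \<in> aut (dc_V V) (dc_E E)"
proof -
  have inj: "inj_on \<sigma> V" and surj: "\<sigma> ` V = V"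
    using aut_bij[OF assms] by (auto simp: bij_betw_def)
  have "inj_on (lift V \<sigma> s) (dc_V V)"
    using inj by (auto simp: inj_on_def lift_def dc_V_def)
  moreover have "lift V \<sigma> s ` dc_V V = dc_V V"
  proof
    show "lift V \<sigma> s ` dc_V V \<subseteq> dc_V V"
      using surj by (auto simp: lift_def dc_V_def)
    show "dc_V V \<subseteq> lift V \<sigma> s ` dc_V V"
    proof
      fix p assume "p \<in> dc_V V"
      then obtain v x where "p = (\<sigma> v, x)" "v \<in> V"
        using surj unfolding dc_V_def by (metis imageE mem_Sigma_iff prod.exhaust_sel)
      then have "p = lift V \<sigma> s (v, x \<noteq> s)" "(v, x \<noteq> s) \<in> dc_V V"
        by (auto simp: lift_def dc_V_def)
      then show "p \<in> lift V \<sigma> s ` dc_V V"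
        by blast
    qed
  qed
  ultimately show ?thesis
    using aut_adj[OF assms] unfolding aut_def bij_betw_def
    by (auto simp: lift_def dc_V_def dc_E_def)
qed

text \<open>The first coordinate of \<open>f\<close> descends to a map \<open>\<sigma>\<close> on
  \<open>V\<close>. On each fibre \<open>f\<close> either keeps or swaps the two copies, adjacent
  vertices make the same choice, and connectedness makes it one global \<open>s\<close>, so
  \<open>f\<close> is \<open>lift V \<sigma> s\<close>.\<close>

lemma stableI:
  assumes conn: "connected_graph V E" and "V \<noteq> {}"
    and fibre: "\<And>f v. f \<in> aut (dc_V V) (dc_E E) \<Longrightarrow> v \<in> V \<Longrightarrow> fst (f (v, True)) = fst (f (v, False))"
  shows "stable V E"
proof -
  have "\<exists>\<sigma> s. \<sigma> \<in> aut V E \<and> f = lift V \<sigma> s" if f: "f \<in> aut (dc_V V) (dc_E E)" for f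
  proof -
    have dc: "(v, x) \<in> dc_V V \<longleftrightarrow> v \<in> V" for v x
      by (simp add: dc_V_def)
    define \<sigma> where "\<sigma> v = (if v \<in> V then fst (f (v, False)) else v)" for v
    have fst_f: "fst (f (v, x)) = \<sigma> v" if "v \<in> V" for v x
      using fibre[OF f that] that by (cases x) (auto simp: \<sigma>_def)
    have flip: "snd (f (v, True)) \<noteq> snd (f (v, False))" if "v \<in> V" for v
    proof
      assume "snd (f (v, True)) = snd (f (v, False))"
      then have "f (v, True) = f (v, False)"
        by (simp add: prod_eq_iff fst_f that)
      then show False
        using aut_inj[OF f, of "(v, True)" "(v, False)"] that by (simp add: dc)
    qed
    have \<sigma>_mem: "\<sigma> v \<in> V" if "v \<in> V" for v
      using aut_mem[OF f, of "(v, False)"] that fst_f[OF that, of False]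
      by (auto simp: dc_V_def mem_Times_iff)
    have edge: "E u v \<and> x \<noteq> y \<longleftrightarrow> E (\<sigma> u) (\<sigma> v) \<and> snd (f (u, x)) \<noteq> snd (f (v, y))"
      if "u \<in> V" "v \<in> V" for u v x y
      using aut_adj[OF f, of "(u, x)" "(v, y)"] that by (auto simp: dc dc_E_def fst_f)
    obtain v0 where v0: "v0 \<in> V"
      using \<open>V \<noteq> {}\<close> by blast
    define s where "s = snd (f (v0, False))"
    \<comment> \<open>If \<open>y\<close> and \<open>z\<close> are adjacent, so are
      \<open>(y, False)\<close> and \<open>(z, True)\<close>; their images differ in the second
      coordinate, and \<open>flip\<close> turns this into equality for
      \<open>(z, False)\<close>.\<close>
    have const: "snd (f (v, False)) = s" if "v \<in> V" for v
    proof -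
      have "(\<lambda>a b. a \<in> V \<and> b \<in> V \<and> E a b)\<^sup>*\<^sup>* v0 v"
        using conn v0 that by (auto simp: connected_graph_def)
      then show ?thesis
      proof induction
        case (step y z)
        then show ?case
          using edge[of y z False True] flip[of z] by auto
      qed (simp add: s_def)
    qed
    have snd_f: "snd (f (v, x)) = (x \<noteq> s)" if "v \<in> V" for v x
      using const[OF that] flip[OF that] by (cases x) auto
    have f_eq: "f = lift V \<sigma> s"
    proof
      fix p :: "'a \<times> bool"
      obtain v x where p: "p = (v, x)"
        by force
      show "f p = lift V \<sigma> s p"
      proof (cases "v \<in> V")
        case True
        then show ?thesis
          by (simp add: p lift_def prod_eq_iff fst_f snd_f)
      next
        case False
        then show ?thesis
          using aut_out[OF f, of p] by (simp add: p lift_def dc)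
      qed
    qed
    have "inj_on \<sigma> V"
    proof (rule inj_onI)
      fix u v assume *: "u \<in> V" "v \<in> V" "\<sigma> u = \<sigma> v"
      then have "f (u, False) = f (v, False)"
        by (simp add: prod_eq_iff fst_f snd_f)
      then show "u = v"
        using aut_inj[OF f, of "(u, False)" "(v, False)"] * by (simp add: dc)
    qed
    moreover have "v \<in> \<sigma> ` V" if "v \<in> V" for v
    proof -
      have "f ` dc_V V = dc_V V"
        using aut_bij[OF f] by (simp add: bij_betw_def)
      then have "(v, False) \<in> f ` dc_V V"
        using that by (simp add: dc)
      then obtain w y where "w \<in> V" "f (w, y) = (v, False)"
        by (auto simp: dc_V_def)
      then show ?thesis
        using fst_f[of w y] by auto
    qed
    ultimately have "bij_betw \<sigma> V V"
      using \<sigma>_mem by (auto simp: bij_betw_def)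
    moreover have "E u v \<longleftrightarrow> E (\<sigma> u) (\<sigma> v)" if "u \<in> V" "v \<in> V" for u v
      using edge[OF that, of False True] snd_f that by auto
    ultimately have "\<sigma> \<in> aut V E"
      by (simp add: aut_def \<sigma>_def)
    then show ?thesis
      using f_eq by blast
  qed
  then show ?thesis
    unfolding stable_def using lift_in_aut by blast
qed

lemma stableD:
  assumes "stable V E" "f \<in> aut (dc_V V) (dc_E E)" "v \<in> V"
  shows "fst (f (v, True)) = fst (f (v, False))"
  using assms by (auto simp: stable_def lift_def)

section \<open>Counting closed non-backtracking walks\<close>

text \<open>The condition \<open>p \<noteq> y\<close> excludes closed walks with a tail: the walks counted by
\<open>nbwalks V E 7 x y x y\<close> start with the arc \<open>(x, y)\<close> and are non-backtracking also cyclically.\<close>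
primrec nbwalks :: "'a set \<Rightarrow> ('a \<Rightarrow> 'a \<Rightarrow> bool) \<Rightarrow> nat \<Rightarrow> 'a \<Rightarrow> 'a \<Rightarrow> 'a \<Rightarrow> 'a \<Rightarrow> nat" where
  "nbwalks V E 0 p q x y = of_bool (q = x \<and> p \<noteq> y)"
| "nbwalks V E (Suc l) p q x y = (\<Sum>w\<in>nbhd V E q - {p}. nbwalks V E l q w x y)"

text \<open>Length 8 is natural because the relation 1 + k - 1 - k = 0, with four spokes in between,
  closes an 8-walk in every generalized Petersen graph.\<close>

definition cyc8 :: "'a set \<Rightarrow> ('a \<Rightarrow> 'a \<Rightarrow> bool) \<Rightarrow> 'a \<Rightarrow> 'a \<Rightarrow> nat" where
  "cyc8 V E x y = nbwalks V E 7 x y x y"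

lemma nbwalks_aut:
  assumes f: "f \<in> aut V E" and "x \<in> V" "y \<in> V"
  shows "p \<in> V \<Longrightarrow> q \<in> V \<Longrightarrow> nbwalks V E l (f p) (f q) (f x) (f y) = nbwalks V E l p q x y"
proof (induction l arbitrary: p q)
  case 0
  then show ?case
    using assms by (simp add: aut_inj[OF f])
next
  case (Suc l)
  have nb: "nbhd V E q \<subseteq> V"
    by (auto simp: nbhd_def)
  have inj: "inj_on f V"
    using aut_bij[OF f] by (simp add: bij_betw_def)
  have "nbhd V E (f q) - {f p} = f ` (nbhd V E q - {p})"
    using aut_nbhd[OF f Suc.prems(2)] nb inj Suc.prems(1) by (auto simp: inj_on_def)
  moreover have "inj_on f (nbhd V E q - {p})"
    using nb inj by (meson Diff_subset inj_on_subset)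
  moreover have "nbwalks V E l (f q) (f w) (f x) (f y) = nbwalks V E l q w x y"
    if "w \<in> nbhd V E q - {p}" for w
    using that nb by (intro Suc.IH Suc.prems(2)) auto
  ultimately show ?case
    by (simp add: sum.reindex)
qed

lemma cyc8_aut:
  "f \<in> aut V E \<Longrightarrow> x \<in> V \<Longrightarrow> y \<in> V \<Longrightarrow> cyc8 V E (f x) (f y) = cyc8 V E x y"
  unfolding cyc8_def by (rule nbwalks_aut)

primrec walk_ends :: "'a set \<Rightarrow> ('a \<Rightarrow> 'a \<Rightarrow> bool) \<Rightarrow> nat \<Rightarrow> 'a \<Rightarrow> 'a set" where
  "walk_ends V E 0 x = {x}"
| "walk_ends V E (Suc l) x = (\<Union>w\<in>walk_ends V E l x. nbhd V E w)"

lemma walk_ends_subset: "x \<in> V \<Longrightarrow> walk_ends V E l x \<subseteq> V"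
  by (cases l) (auto simp: nbhd_def)

lemma walk_ends_aut:
  assumes "f \<in> aut V E" "x \<in> V"
  shows "walk_ends V E l (f x) = f ` walk_ends V E l x"
proof (induction l)
  case (Suc l)
  have "nbhd V E (f w) = f ` nbhd V E w" if "w \<in> walk_ends V E l x" for w
    using aut_nbhd[OF assms(1)] walk_ends_subset[OF assms(2)] that by blast
  then show ?case
    by (simp add: Suc.IH image_UN)
qed simp

section \<open>Offsets of closed walks\<close>

text \<open>The offsets \<open>(\<alpha>, \<beta>)\<close>, standing for \<open>\<alpha> + \<beta> k\<close>, reached by continuing a walk by \<open>l\<close> steps from a
vertex of type \<open>b\<close>. A step is coded by 0 (spoke), 1 or -1, so that -\<open>d\<close> is the reverse of \<open>d\<close>. Only
walks ending at type \<open>b0\<close> with a last step that does not cancel the first step \<open>d0\<close> count.\<close>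
fun offsets :: "bool \<Rightarrow> int \<Rightarrow> nat \<Rightarrow> bool \<Rightarrow> int \<Rightarrow> int \<Rightarrow> int \<Rightarrow> (int \<times> int) list" where
  "offsets b0 d0 0 b d \<alpha> \<beta> = (if b = b0 \<and> d \<noteq> - d0 then [(\<alpha>, \<beta>)] else [])"
| "offsets b0 d0 (Suc l) b d \<alpha> \<beta> =
     (if d = 0 then [] else offsets b0 d0 l (\<not> b) 0 \<alpha> \<beta>) @
     (if d = - 1 then [] else offsets b0 d0 l b 1 (if b then \<alpha> else \<alpha> + 1) (if b then \<beta> + 1 else \<beta>)) @
     (if d = 1 then [] else offsets b0 d0 l b (- 1) (if b then \<alpha> else \<alpha> - 1) (if b then \<beta> - 1 else \<beta>))"

definition closes :: "nat \<Rightarrow> nat \<Rightarrow> int \<Rightarrow> int \<Rightarrow> nat" where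
  "closes n k p q = of_bool (int n dvd p + q * int k)"

text \<open>A closed 8-walk with two spokes has p outer and q inner steps with |p| + |q| = 6. It
  contributes |p| possible first arcs to this count, |q| to \<open>count_inner\<close> and one to
  \<open>count_spoke\<close>, where both \<open>(p, q)\<close> and its negative occur. Offsets with
  |p| = |q| = 2 belong to walks with four spokes. The constant terms count the walks of offset (0,
  0), which always close.\<close>

definition count_outer :: "nat \<Rightarrow> nat \<Rightarrow> nat" where
  "count_outer n k = 2 + closes n k 2 2 + closes n k (-2) 2 + 5 * (closes n k 5 1 + closes n k (-5) 1)
  + 4 * (closes n k 4 2 + closes n k (-4) 2)
  + 3 * (closes n k 3 3 + closes n k (-3) 3) + 2 * (closes n k 2 4 + closes n k (-2) 4) + (closes n k 1 5 + closes n k (-1) 5) + closes n k 8 0"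

definition count_inner :: "nat \<Rightarrow> nat \<Rightarrow> nat" where
  "count_inner n k = 2 + closes n k 2 2 + closes n k (-2) 2 + (closes n k 5 1 + closes n k (-5) 1)
  + 2 * (closes n k 4 2 + closes n k (-4) 2)
  + 3 * (closes n k 3 3 + closes n k (-3) 3) + 4 * (closes n k 2 4 + closes n k (-2) 4) + 5 * (closes n k 1 5 + closes n k (-1) 5) + closes n k 0 8"

definition count_spoke :: "nat \<Rightarrow> nat \<Rightarrow> nat" where
  "count_spoke n k = 4 + 2 * (closes n k 2 2 + closes n k (-2) 2 + closes n k 5 1 + closes n k (-5) 1
  + closes n k 4 2 + closes n k (-4) 2
  + closes n k 3 3 + closes n k (-3) 3 + closes n k 2 4 + closes n k (-2) 4 + closes n k 1 5 + closes n k (-1) 5)"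

text \<open>The finite range left open by the argument for n > 26; there 2k < n gives k <
  13.\<close>

lemma count_small:
  "\<forall>n\<in>set [3..<27]. \<forall>k\<in>set [1..<13]. 2 * k < n \<longrightarrow> count_outer n k = count_spoke n k \<longrightarrow>
    count_inner n k = count_spoke n k \<longrightarrow>
    (n, k) \<in> {(4, 1), (5, 2), (8, 3), (10, 2), (10, 3), (12, 5), (13, 5), (24, 5), (26, 5)}"
  by code_simp

text \<open>Executable model of the neighbourhoods, with indices taken relative to a start vertex.
  The copy in the double cover is omitted, being determined by the parity of the walk
  length.\<close>

fun reach_nbrs :: "nat \<Rightarrow> nat \<Rightarrow> bool \<times> int \<Rightarrow> (bool \<times> int) list" where
  "reach_nbrs n k (c, j) = (let s = if c then int k else 1 in
    [(c, (j + s) mod int n), (c, (j - s) mod int n), (\<not> c, j)])"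

definition reach_step :: "nat \<Rightarrow> nat \<Rightarrow> (bool \<times> int) list \<Rightarrow> (bool \<times> int) list" where
  "reach_step n k L = remdups (concat (map (reach_nbrs n k) L))"

text \<open>Walks of length 3 and 4 in the double cover together end everywhere except at the other
  copy of their start.\<close>

lemma reach_5_2: "\<forall>b\<in>set [False, True].
    set ((reach_step 5 2 ^^ 3) [(b, 0)]) = set (List.product [False, True] [0..int 5 - 1]) - {(b, 0)} \<and>
    set ((reach_step 5 2 ^^ Suc 3) [(b, 0)]) = set (List.product [False, True] [0..int 5 - 1])"
  by code_simp

lemma reach_13_5: "\<forall>b\<in>set [False, True].
    set ((reach_step 13 5 ^^ 5) [(b, 0)]) = set (List.product [False, True] [0..int 13 - 1]) - {(b, 0)} \<and>
    set ((reach_step 13 5 ^^ Suc 5) [(b, 0)]) = set (List.product [False, True] [0..int 13 - 1])"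
  by code_simp

section \<open>Double covers of generalized Petersen graphs\<close>

locale petersen =
  fixes n k :: nat
  assumes k_pos: "1 \<le> k" and k_less: "2 * k < n"
begin

abbreviation "V \<equiv> gp_V n"
abbreviation "E \<equiv> gp_E n k"
abbreviation "DV \<equiv> dc_V V"
abbreviation "DE \<equiv> dc_E E"

definition \<kappa> :: "bool \<Rightarrow> int" where
  "\<kappa> b = (if b then int k else 1)"

text \<open>Indices are arbitrary integers, so equality and adjacency become divisibility by
  \<open>n\<close> of plain integer expressions.\<close>

definition gv :: "bool \<Rightarrow> int \<Rightarrow> bool \<times> nat" where
  "gv b i = (b, nat (i mod int n))"

definition vx :: "bool \<Rightarrow> int \<Rightarrow> bool \<Rightarrow> (bool \<times> nat) \<times> bool" where
  "vx b i x = (gv b i, x)"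

lemma n_ge: "3 \<le> n"
  using k_pos k_less by linarith

lemma gv_eq: "gv b i = gv c j \<longleftrightarrow> b = c \<and> int n dvd i - j"
  using n_ge by (simp add: gv_def eq_nat_nat_iff flip: mod_eq_dvd_iff)

lemma gv_mem: "gv b i \<in> V"
  using n_ge by (simp add: gv_def gp_V_def nat_less_iff)

lemma gv_cases:
  assumes "v \<in> V" obtains b i where "v = gv b i"
proof -
  have "v = gv (fst v) (int (snd v))"
    using assms by (auto simp: gv_def gp_V_def)
  then show ?thesis
    using that by blast
qed

lemma gv_adj: "E (gv b i) (gv c j) \<longleftrightarrow>
    (if b = c then int n dvd j - i - \<kappa> b \<or> int n dvd j - i + \<kappa> b else int n dvd i - j)"
proof -
  have lt: "nat (i mod int n) < n" for i
    using n_ge by (simp add: nat_less_iff)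
  have shift: "nat (j mod int n) = (nat (i mod int n) + t) mod n \<longleftrightarrow> int n dvd j - i - int t" for i j t
  proof -
    have "int (nat (j mod int n)) = j mod int n"
      "int ((nat (i mod int n) + t) mod n) = (i + int t) mod int n"
      using n_ge by (simp_all add: zmod_int mod_add_left_eq)
    then have "nat (j mod int n) = (nat (i mod int n) + t) mod n \<longleftrightarrow> j mod int n = (i + int t) mod int n"
      by (metis of_nat_eq_iff)
    then show ?thesis
      by (simp add: mod_eq_dvd_iff algebra_simps)
  qed
  have sym: "int n dvd i - j - t \<longleftrightarrow> int n dvd j - i + t" for t
    by (metis (no_types, opaque_lifting) diff_diff_eq2 dvd_minus_iff minus_diff_eq add.commute diff_diff_eq diff_add_eq)
  have "nat (i mod int n) = nat (j mod int n) \<longleftrightarrow> int n dvd i - j"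
    using n_ge by (simp add: eq_nat_nat_iff flip: mod_eq_dvd_iff)
  then show ?thesis
    using shift[of j i 1] shift[of i j 1] shift[of j i k] shift[of i j k]
    by (auto simp: gp_E_def gv_def lt \<kappa>_def sym)
qed

lemma vx_eq: "vx b i x = vx c j y \<longleftrightarrow> b = c \<and> x = y \<and> int n dvd i - j"
  by (auto simp: vx_def gv_eq)

lemma vx_mem: "vx b i x \<in> DV"
  by (simp add: vx_def dc_V_def gv_mem)

lemma vx_cases:
  assumes "p \<in> DV" obtains b i x where "p = vx b i x"
proof -
  obtain v x where "p = (v, x)" "v \<in> V"
    using assms by (auto simp: dc_V_def)
  moreover obtain b i where "v = gv b i"
    using \<open>v \<in> V\<close> by (rule gv_cases)
  ultimately show ?thesis
    using that by (auto simp: vx_def)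
qed

lemma vx_adj: "DE (vx b i x) (vx c j y) \<longleftrightarrow> x \<noteq> y \<and>
    (if b = c then int n dvd j - i - \<kappa> b \<or> int n dvd j - i + \<kappa> b else int n dvd i - j)"
  by (auto simp: vx_def dc_E_def gv_adj)

text \<open>The steps are coded as in \<open>offsets\<close>: a step \<open>d\<close> is undone by
  the step \<open>- d\<close> from the new vertex.\<close>

definition move :: "bool \<Rightarrow> int \<Rightarrow> bool \<Rightarrow> int \<Rightarrow> (bool \<times> nat) \<times> bool" where
  "move b i x d = (if d = 0 then vx (\<not> b) i (\<not> x) else vx b (i + d * \<kappa> b) (\<not> x))"

lemma move_mem: "move b i x d \<in> DV"
  by (simp add: move_def vx_mem)

lemma not_dvd_small: "int n dvd t \<Longrightarrow> \<bar>t\<bar> < int n \<Longrightarrow> t = 0"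
  using zdvd_imp_le[of "int n" "\<bar>t\<bar>"] by (cases "t = 0") auto

lemma not_dvd_kappa: "\<not> int n dvd \<kappa> b" "\<not> int n dvd 2 * \<kappa> b"
  using not_dvd_small[of "\<kappa> b"] not_dvd_small[of "2 * \<kappa> b"] k_pos k_less by (auto simp: \<kappa>_def)

lemma move_inj: "d \<in> {0, 1, -1} \<Longrightarrow> e \<in> {0, 1, -1} \<Longrightarrow> move b i x d = move b i x e \<longleftrightarrow> d = e"
  using not_dvd_kappa[of b] by (auto simp: move_def vx_eq)

lemma dvd_shift: "int n dvd i - j - t \<longleftrightarrow> int n dvd j - i + t"
proof -
  have "j - i + t = - (i - j - t)"
    by simp
  then show ?thesis
    by (simp only: dvd_minus_iff)
qed

lemma nbhd_vx: "nbhd DV DE (vx b i x) = move b i x ` {0, 1, -1}"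
proof
  show "nbhd DV DE (vx b i x) \<subseteq> move b i x ` {0, 1, -1}"
  proof
    fix p assume "p \<in> nbhd DV DE (vx b i x)"
    then have "p \<in> DV" and adj: "DE (vx b i x) p"
      by (auto simp: nbhd_def)
    then obtain c j y where p: "p = vx c j y"
      using vx_cases by blast
    show "p \<in> move b i x ` {0, 1, -1}"
      using adj dvd_shift[of j i "\<kappa> b"] dvd_shift[of j i "- \<kappa> b"]
      by (cases x) (auto simp: p vx_adj move_def vx_eq algebra_simps dvd_diff_commute split: if_splits)
  qed
  show "move b i x ` {0, 1, -1} \<subseteq> nbhd DV DE (vx b i x)"
    by (auto simp: nbhd_def move_def vx_mem vx_adj)
qed

text \<open>The previous vertex is always the step \<open>- d\<close> away, so forbidding it forbids
  that step. The copy \<open>c\<close> is fixed by the parity of the remaining steps, hence closing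
  up depends only on the type and the offset.\<close>

lemma nbwalks_offsets:
  assumes d0: "d0 \<in> {0, 1, -1}"
  shows "d \<in> {0, 1, -1} \<Longrightarrow> c = (x \<noteq> odd l) \<Longrightarrow> j = i + \<alpha> + \<beta> * int k \<Longrightarrow>
    nbwalks DV DE l (move b j c (- d)) (vx b j c) (vx b0 i x) (move b0 i x d0)
      = (\<Sum>(\<alpha>, \<beta>)\<leftarrow>offsets b0 d0 l b d \<alpha> \<beta>. of_bool (int n dvd \<alpha> + \<beta> * int k))"
proof (induction l arbitrary: b d \<alpha> \<beta> c j)
  case 0
  have mem: "- d \<in> {0, 1, -1}"
    using 0(1) by auto
  show ?case
  proof (cases "b = b0 \<and> int n dvd j - i")
    case True
    then have "move b j c (- d) = move b0 i x (- d)"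
      using 0(2) by (simp add: move_def vx_eq)
    then show ?thesis
      using True 0(2,3) move_inj[OF mem d0] by (auto simp: vx_eq)
  next
    case False
    then show ?thesis
      using 0(3) by (auto simp: vx_eq)
  qed
next
  case (Suc l)
  let ?g = "\<lambda>w. nbwalks DV DE l (vx b j c) w (vx b0 i x) (move b0 i x d0)"
  let ?S = "\<lambda>(\<alpha>, \<beta>). of_bool (int n dvd \<alpha> + \<beta> * int k) :: nat"
  have mem: "- d \<in> {0, 1, -1}"
    using Suc.prems(1) by auto
  have inj: "inj_on (move b j c) {0, 1, -1}"
    using move_inj by (meson inj_onI)
  have "nbhd DV DE (vx b j c) - {move b j c (- d)} = move b j c ` ({0, 1, -1} - {- d})"
    using inj_on_image_set_diff[OF inj, of "{0, 1, -1}" "{- d}"] mem by (simp add: nbhd_vx)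
  moreover have "inj_on (move b j c) ({0, 1, -1} - {- d})"
    using inj by (rule inj_on_subset) blast
  ultimately have "nbwalks DV DE (Suc l) (move b j c (- d)) (vx b j c) (vx b0 i x) (move b0 i x d0)
      = (\<Sum>e\<in>{0, 1, -1} - {- d}. ?g (move b j c e))"
    by (simp add: sum.reindex)
  also have "\<dots> = (if d = 0 then 0 else ?g (move b j c 0)) + ((if d = - 1 then 0 else ?g (move b j c 1))
      + (if d = 1 then 0 else ?g (move b j c (- 1))))"
  proof -
    have "{0, 1, -1} - {0} = {1, -1 :: int}" "{0, 1, -1} - {1} = {0, -1 :: int}"
      "{0, 1, -1} - {-1} = {0, 1 :: int}"
      by auto
    then show ?thesis
      using Suc.prems(1) by auto
  qed
  also have "?g (move b j c 0) = (\<Sum>p\<leftarrow>offsets b0 d0 l (\<not> b) 0 \<alpha> \<beta>. ?S p)"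
    using Suc.IH[of 0 "\<not> c" j \<alpha> \<beta> "\<not> b"] Suc.prems(2,3) by (simp add: move_def)
  also have "?g (move b j c 1) = (\<Sum>p\<leftarrow>offsets b0 d0 l b 1 (if b then \<alpha> else \<alpha> + 1)
      (if b then \<beta> + 1 else \<beta>). ?S p)"
    using Suc.IH[of 1 "\<not> c" "j + \<kappa> b" "if b then \<alpha> else \<alpha> + 1" "if b then \<beta> + 1 else \<beta>" b] Suc.prems(2,3)
    by (simp add: move_def \<kappa>_def algebra_simps)
  also have "?g (move b j c (- 1)) = (\<Sum>p\<leftarrow>offsets b0 d0 l b (- 1) (if b then \<alpha> else \<alpha> - 1)
      (if b then \<beta> - 1 else \<beta>). ?S p)"
    using Suc.IH[of "- 1" "\<not> c" "j - \<kappa> b" "if b then \<alpha> else \<alpha> - 1" "if b then \<beta> - 1 else \<beta>" b] Suc.prems(2,3)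
    by (simp add: move_def \<kappa>_def algebra_simps)
  finally show ?case
    by simp
qed

lemma cyc8_move:
  assumes "d \<in> {0, 1, -1}"
  shows "cyc8 DV DE (vx b i x) (move b i x d)
    = (\<Sum>(\<alpha>, \<beta>)\<leftarrow>offsets b d 7 (if d = 0 then \<not> b else b) d
        (if b then 0 else d) (if b then d else 0). of_bool (int n dvd \<alpha> + \<beta> * int k))"
proof (cases "d = 0")
  case True
  show ?thesis
    using nbwalks_offsets[of d d "\<not> x" x 7 i i 0 0 "\<not> b" b] assms
    by (simp add: cyc8_def move_def True)
next
  case False
  show ?thesis
    using nbwalks_offsets[of d d "\<not> x" x 7 "i + d * \<kappa> b" i "if b then 0 else d" "if b then d else 0" b b]
      assms False
    by (cases b) (simp_all add: cyc8_def move_def \<kappa>_def)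
qed

section \<open>Counts of closed 8-walks\<close>

lemma closes_minus: "closes n k (- p) (- q) = closes n k p q"
proof -
  have "- p + - q * int k = - (p + q * int k)"
    by simp
  then show ?thesis
    by (simp only: closes_def dvd_minus_iff)
qed

text \<open>A sign convention for offsets, under which the sums over all walks collect into the
  terms of the three count formulas.\<close>

lemma closes_normalize:
  "closes n k p (- numeral q) = closes n k (- p) (numeral q)" "closes n k p (- 1) = closes n k (- p) 1"
  "closes n k (- numeral m) 0 = closes n k (numeral m) 0"
  using closes_minus[of "- p" "numeral q"] closes_minus[of "- p" 1] closes_minus[of "numeral m" 0] by simp_all

lemma closes_trivial: "closes n k 0 0 = 1" "closes n k 2 0 = 0" "closes n k 0 2 = 0"
  using not_dvd_kappa(2)[of False] not_dvd_kappa(2)[of True] by (simp_all add: closes_def \<kappa>_def)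

lemma cyc8_spoke: "cyc8 DV DE (vx b i x) (move b i x 0) = count_spoke n k"
  unfolding cyc8_move[of 0, simplified] closes_def[symmetric]
  by (cases b) (simp_all add: eval_nat_numeral closes_normalize closes_trivial count_spoke_def)

lemma cyc8_outer: 
  assumes "d \<in> {1, -1}"
  shows "cyc8 DV DE (vx False i x) (move False i x d) = count_outer n k"
proof -
  have "d \<in> {0, 1, -1}"
    using assms by auto
  then show ?thesis
    unfolding cyc8_move[OF \<open>d \<in> {0, 1, -1}\<close>] closes_def[symmetric]
    using assms by (auto simp add: eval_nat_numeral closes_normalize closes_trivial count_outer_def)
qed

lemma cyc8_inner: 
  assumes "d \<in> {1, -1}"
  shows "cyc8 DV DE (vx True i x) (move True i x d) = count_inner n k"
proof -
  have "d \<in> {0, 1, -1}"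
    using assms by auto
  then show ?thesis
    unfolding cyc8_move[OF \<open>d \<in> {0, 1, -1}\<close>] closes_def[symmetric]
    using assms by (auto simp add: eval_nat_numeral closes_normalize closes_trivial count_inner_def)
qed

section \<open>Comparison of the three counts\<close>

lemma dvd_range:
  assumes "- int n < t" "t < 4 * int n"
  shows "int n dvd t \<longleftrightarrow> t = 0 \<or> t = int n \<or> t = 2 * int n \<or> t = 3 * int n"
proof
  assume "int n dvd t"
  then obtain c where c: "t = int n * c"
    by blast
  have "int n * (-1) < int n * c"
    using c assms(1) by simp
  then have "-1 < c"
    using n_ge by (simp only: mult_less_cancel_left_pos)
  moreover have "c < 4"
    using c assms(2) n_ge by (simp add: mult.commute)
  ultimately have "c = 0 \<or> c = 1 \<or> c = 2 \<or> c = 3"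
    by linarith
  then show "t = 0 \<or> t = int n \<or> t = 2 * int n \<or> t = 3 * int n"
    using c by auto
qed auto

text \<open>For large \<open>n\<close> each congruence becomes a few linear equations between
  \<open>n\<close> and \<open>k\<close>. One of six such equations must hold; each excludes most of
  the others, and the counts then differ. The bound is sharp: the counts agree for (26, 5), where 5k
  + 1 = n.\<close>

lemma count_large:
  assumes "26 < n" and eq: "count_outer n k = count_spoke n k" "count_inner n k = count_spoke n k"
  shows False
proof -
  define N K where "N = int n" and "K = int k"
  have b: "26 < N" "1 \<le> K" "2 * K < N"
    using assms(1) k_pos k_less by (simp_all add: N_def K_def)
  \<comment> \<open>\<open>Q\<close> stands for any simplified form of the four possible equations;
    since 8k < 4n, all offsets needed lie in the range where only these multiples of
    \<open>n\<close> occur.\<close>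
  have r: "closes n k p q = of_bool Q"
    if "- N < p + q * K" "p + q * K < 4 * N"
      "Q \<longleftrightarrow> p + q * K = 0 \<or> p + q * K = N \<or> p + q * K = 2 * N \<or> p + q * K = 3 * N" for p q Q
    using dvd_range[of "p + q * K"] that by (simp add: closes_def N_def K_def)
  have rels: "closes n k 5 1 = of_bool False" "closes n k 8 0 = of_bool False"
    "closes n k (-5) 1 = of_bool (K = 5)"
    "closes n k 4 2 = of_bool (2 * K + 4 = N)"
    "closes n k (-4) 2 = of_bool (K = 2)"
    "closes n k 3 3 = of_bool (3 * K + 3 = N)"
    "closes n k (-3) 3 = of_bool (K = 1 \<or> 3 * K - 3 = N)"
    "closes n k 2 4 = of_bool (4 * K + 2 = N \<or> 4 * K + 2 = 2 * N)"
    "closes n k (-2) 4 = of_bool (4 * K - 2 = N)"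
    "closes n k 1 5 = of_bool (5 * K + 1 = N \<or> 5 * K + 1 = 2 * N)"
    "closes n k (-1) 5 = of_bool (5 * K - 1 = N \<or> 5 * K - 1 = 2 * N)"
    "closes n k 0 8 = of_bool (8 * K = N \<or> 8 * K = 2 * N \<or> 8 * K = 3 * N)"
    "closes n k 2 2 = of_bool (2 * K + 2 = N)"
    "closes n k (-2) 2 = of_bool (K = 1)"
    by (rule r; use b in \<open>linarith | smt (verit)\<close>)+
  consider "K = 1" | "K = 2" | "K = 5" | "2 * K + 4 = N" | "3 * K + 3 = N" | "3 * K - 3 = N"
  proof -
    \<comment> \<open>In the outer count minus the spoke count the constant is -2, and only the
      offsets (5,1), (4,2), (3,3), up to signs, and (8,0) have positive coefficients. One of them
      must close.\<close>
    have "K = 1 \<or> K = 2 \<or> K = 5 \<or> 2 * K + 4 = N \<or> 3 * K + 3 = N \<or> 3 * K - 3 = N"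
    proof (rule ccontr)
      assume "\<not> ?thesis"
      then have "closes n k (-5) 1 = 0" "closes n k 4 2 = 0" "closes n k (-4) 2 = 0" "closes n k 3 3 = 0" "closes n k (-3) 3 = 0"
        by (simp_all add: rels)
      then show False
        using eq(1) by (simp add: count_outer_def count_spoke_def rels(1,2))
    qed
    then show ?thesis
      using that by blast
  qed
  then show False
  proof cases
    case 1
    then have "\<not> (K = 5)" "\<not> (2 * K + 4 = N)" "\<not> (K = 2)" "\<not> (3 * K + 3 = N)" "\<not> (4 * K + 2 = N \<or> 4 * K + 2 = 2 * N)" "\<not> (4 * K - 2 = N)" "\<not> (5 * K + 1 = N \<or> 5 * K + 1 = 2 * N)" "\<not> (5 * K - 1 = N \<or> 5 * K - 1 = 2 * N)" "\<not> (8 * K = N \<or> 8 * K = 2 * N \<or> 8 * K = 3 * N)" "\<not> (2 * K + 2 = N)"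
      using b by linarith+
    then show ?thesis
      using eq unfolding count_outer_def count_inner_def count_spoke_def rels by (simp add: 1)
  next
    case 2
    then have "\<not> (K = 5)" "\<not> (2 * K + 4 = N)" "\<not> (3 * K + 3 = N)" "\<not> (K = 1 \<or> 3 * K - 3 = N)" "\<not> (4 * K + 2 = N \<or> 4 * K + 2 = 2 * N)" "\<not> (4 * K - 2 = N)" "\<not> (5 * K + 1 = N \<or> 5 * K + 1 = 2 * N)" "\<not> (5 * K - 1 = N \<or> 5 * K - 1 = 2 * N)" "\<not> (8 * K = N \<or> 8 * K = 2 * N \<or> 8 * K = 3 * N)" "\<not> (2 * K + 2 = N)" "\<not> (K = 1)"
      using b by linarith+
    then show ?thesis
      using eq unfolding count_outer_def count_inner_def count_spoke_def rels by (simp add: 2)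
  next
    case 3
    then have "\<not> (2 * K + 4 = N)" "\<not> (K = 2)" "\<not> (3 * K + 3 = N)" "\<not> (K = 1 \<or> 3 * K - 3 = N)" "\<not> (4 * K + 2 = N \<or> 4 * K + 2 = 2 * N)" "\<not> (4 * K - 2 = N)" "\<not> (5 * K + 1 = N \<or> 5 * K + 1 = 2 * N)" "\<not> (5 * K - 1 = N \<or> 5 * K - 1 = 2 * N)" "\<not> (2 * K + 2 = N)" "\<not> (K = 1)"
      using b by linarith+
    then show ?thesis
      using eq unfolding count_outer_def count_inner_def count_spoke_def rels by (simp add: 3)
  next
    case 4
    then have "\<not> (K = 5)" "\<not> (K = 2)" "\<not> (3 * K + 3 = N)" "\<not> (K = 1 \<or> 3 * K - 3 = N)" "\<not> (4 * K + 2 = N \<or> 4 * K + 2 = 2 * N)" "\<not> (4 * K - 2 = N)" "\<not> (5 * K + 1 = N \<or> 5 * K + 1 = 2 * N)" "\<not> (5 * K - 1 = N \<or> 5 * K - 1 = 2 * N)" "\<not> (8 * K = N \<or> 8 * K = 2 * N \<or> 8 * K = 3 * N)" "\<not> (2 * K + 2 = N)" "\<not> (K = 1)"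
      using b by linarith+
    then show ?thesis
      using eq unfolding count_outer_def count_inner_def count_spoke_def rels by (simp add: 4)
  next
    case 5
    then have "\<not> (K = 5)" "\<not> (2 * K + 4 = N)" "\<not> (K = 2)" "\<not> (K = 1 \<or> 3 * K - 3 = N)" "\<not> (4 * K + 2 = N \<or> 4 * K + 2 = 2 * N)" "\<not> (4 * K - 2 = N)" "\<not> (5 * K + 1 = N \<or> 5 * K + 1 = 2 * N)" "\<not> (5 * K - 1 = N \<or> 5 * K - 1 = 2 * N)" "\<not> (8 * K = N \<or> 8 * K = 2 * N \<or> 8 * K = 3 * N)" "\<not> (2 * K + 2 = N)" "\<not> (K = 1)"
      using b by linarith+
    then show ?thesis
      using eq unfolding count_outer_def count_inner_def count_spoke_def rels by (simp add: 5)
  next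
    case 6
    then have "\<not> (K = 5)" "\<not> (2 * K + 4 = N)" "\<not> (K = 2)" "\<not> (3 * K + 3 = N)" "\<not> (4 * K + 2 = N \<or> 4 * K + 2 = 2 * N)" "\<not> (4 * K - 2 = N)" "\<not> (5 * K + 1 = N \<or> 5 * K + 1 = 2 * N)" "\<not> (5 * K - 1 = N \<or> 5 * K - 1 = 2 * N)" "\<not> (8 * K = N \<or> 8 * K = 2 * N \<or> 8 * K = 3 * N)" "\<not> (2 * K + 2 = N)" "\<not> (K = 1)"
      using b by linarith+
    then show ?thesis
      using eq unfolding count_outer_def count_inner_def count_spoke_def rels by (simp add: 6)
  qed
qed

definition spoke_end :: "(bool \<times> nat) \<times> bool \<Rightarrow> (bool \<times> nat) \<times> bool" where
  "spoke_end p = ((\<not> fst (fst p), snd (fst p)), \<not> snd p)"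

lemma spoke_end_vx: "spoke_end (vx b i x) = vx (\<not> b) i (\<not> x)"
  by (simp add: spoke_end_def vx_def gv_def)

lemma move_0: "move b i x 0 = spoke_end (vx b i x)"
  by (simp add: move_def spoke_end_vx)

lemma cyc8_value:
  assumes "d \<in> {1, -1}"
  shows "cyc8 DV DE (vx b i x) (move b i x d) = (if b then count_inner n k else count_outer n k)"
  using cyc8_outer[OF assms] cyc8_inner[OF assms] by (cases b) auto

lemma aut_image:
  assumes "f \<in> aut DV DE" obtains c j y where "f (vx b i x) = vx c j y"
  using that by (rule vx_cases[OF aut_mem[OF assms vx_mem]])

lemma aut_step:
  assumes f: "f \<in> aut DV DE" and "f (vx b i x) = vx c j y" "d \<in> {0, 1, -1}"
  obtains e where "e \<in> {0, 1, -1}" "f (move b i x d) = move c j y e"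
proof -
  have "f (move b i x d) \<in> f ` nbhd DV DE (vx b i x)"
    using assms(3) unfolding nbhd_vx by blast
  then have "f (move b i x d) \<in> move c j y ` {0, 1, -1}"
    using aut_nbhd[OF f vx_mem, of b i x] assms(2) nbhd_vx by simp
  then show ?thesis
    using that by blast
qed

section \<open>Automorphisms preserving the spokes\<close>

text \<open>If the three counts are not all equal, then at each vertex either only the spoke carries the
value of the spokes, or the vertices all of whose arcs carry this value are those of one type.\<close>
lemma spokes_preserved:
  assumes f: "f \<in> aut DV DE"
    and "\<not> (count_outer n k = count_spoke n k \<and> count_inner n k = count_spoke n k)"
    and "p \<in> DV"
  shows "f (spoke_end p) = spoke_end (f p)"
proof -
  let ?c = "\<lambda>b. if b then count_inner n k else count_outer n k"
  let ?flat = "\<lambda>q. \<forall>r\<in>nbhd DV DE q. cyc8 DV DE q r = count_spoke n k"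
  have flat_vx: "?flat (vx b i x) \<longleftrightarrow> ?c b = count_spoke n k" for b i x
    using cyc8_value[of 1 b i x] cyc8_value[of "-1" b i x] cyc8_spoke[of b i x]
    by (auto simp: nbhd_vx)
  have flat_aut: "?flat (f q) \<longleftrightarrow> ?flat q" if "q \<in> DV" for q
  proof -
    have "?flat (f q) \<longleftrightarrow> (\<forall>r\<in>nbhd DV DE q. cyc8 DV DE (f q) (f r) = count_spoke n k)"
      by (simp add: aut_nbhd[OF f that])
    also have "\<dots> \<longleftrightarrow> ?flat q"
      using cyc8_aut[OF f that] by (intro ball_cong) (auto simp: nbhd_def)
    finally show ?thesis .
  qed
  obtain b i x where p: "p = vx b i x"
    using assms(3) vx_cases by blast
  obtain c j y where fp: "f p = vx c j y"
    unfolding p by (rule aut_image[OF f])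
  obtain e where e: "e \<in> {0, 1, -1}" "f (move b i x 0) = move c j y e"
    using aut_step[OF f, of b i x c j y 0] fp p by auto
  have "e = 0"
  proof (rule ccontr)
    assume "e \<noteq> 0"
    then have "e \<in> {1, -1}"
      using e(1) by auto
    have "count_spoke n k = cyc8 DV DE (f p) (f (move b i x 0))"
      using cyc8_aut[OF f vx_mem move_mem, of b i x b i x 0] cyc8_spoke[of b i x] p by simp
    then have c: "?c c = count_spoke n k"
      using cyc8_value[OF \<open>e \<in> {1, -1}\<close>, of c j y] by (simp add: fp e(2))
    \<comment> \<open>The counts are not all equal, so only one type can have the spoke value on all
      its arcs.\<close>
    then have type: "b' = c" if "?flat (vx b' i' x')" for b' i' x'
      using assms(2) that unfolding flat_vx by (cases b'; cases c) auto
    have "?flat (f p)"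
      unfolding fp flat_vx by (rule c)
    then have "?flat (vx b i x)"
      using flat_aut[OF assms(3)] unfolding p by blast
    then have "b = c"
      by (rule type)
    have "f (move b i x 0) = vx c (j + e * \<kappa> c) (\<not> y)"
      unfolding e(2) using \<open>e \<noteq> 0\<close> by (simp add: move_def)
    \<comment> \<open>The image of the other end of the spoke also has type \<open>c\<close>, so
      both ends of one spoke would have the same type.\<close>
    then have "?flat (f (move b i x 0))"
      using c by (simp only: flat_vx)
    then have "?flat (vx (\<not> b) i (\<not> x))"
      using flat_aut[OF move_mem, of b i x 0] by (simp add: move_def)
    then have "(\<not> b) = c"
      by (rule type)
    then show False
      using \<open>b = c\<close> by blast
  qed
  then show ?thesis
    using e(2) fp by (simp add: move_0 p)
qed

context
  fixes f
  assumes f: "f \<in> aut DV DE" and spokes: "\<And>p. p \<in> DV \<Longrightarrow> f (spoke_end p) = spoke_end (f p)"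
begin

lemma aut_straight:
  assumes "f (vx b i x) = vx c j y" "d \<in> {1, -1}"
  obtains e where "e \<in> {1, -1}" "f (move b i x d) = move c j y e"
proof -
  obtain e where e: "e \<in> {0, 1, -1}" "f (move b i x d) = move c j y e"
    using aut_step[OF f assms(1)] assms(2) by blast
  have "f (move b i x 0) = move c j y 0"
    using spokes[OF vx_mem] assms(1) by (simp add: move_0)
  moreover have "move b i x d \<noteq> move b i x 0"
    using move_inj[of d 0] assms(2) by auto
  ultimately have "e \<noteq> 0"
    using aut_inj[OF f move_mem move_mem, of b i x d b i x 0] e(2) by auto
  then show ?thesis
    using that e by blast
qed

text \<open>Spokes go to spokes, so the two remaining directions at a vertex are permuted and
  opposite ones stay opposite.\<close>

lemma aut_opposite:
  assumes "f (vx b i x) = vx c j y" "d \<in> {1, -1}" "e \<in> {1, -1}" "f (move b i x d) = move c j y e"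
  shows "f (move b i x (- d)) = move c j y (- e)"
proof -
  have "- d \<in> {1, -1}"
    using assms(2) by auto
  then obtain e' where e': "e' \<in> {1, -1}" "f (move b i x (- d)) = move c j y e'"
    using aut_straight[OF assms(1)] by blast
  have "move b i x (- d) \<noteq> move b i x d"
    using move_inj[of "- d" d] assms(2) by auto
  then have "e' \<noteq> e"
    using aut_inj[OF f move_mem move_mem, of b i x "- d" b i x d] e'(2) assms(4) by auto
  then have "e' = - e"
    using e'(1) assms(3) by auto
  then show ?thesis
    using e'(2) by simp
qed

text \<open>Two consecutive vertices are carried through the induction: the next image is found as
  opposite to the previous one.\<close>

lemma aut_cycle_dir:
  assumes "f (vx b i x) = vx c j y" "d \<in> {1, -1}" "e \<in> {1, -1}" "f (move b i x d) = move c j y e"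
  shows "f (vx b (i + d * int t * \<kappa> b) (x \<noteq> odd t)) = vx c (j + e * int t * \<kappa> c) (y \<noteq> odd t) \<and>
    f (vx b (i + d * int (Suc t) * \<kappa> b) (x \<noteq> odd (Suc t))) = vx c (j + e * int (Suc t) * \<kappa> c) (y \<noteq> odd (Suc t))"
proof (induction t)
  case 0
  then show ?case
    using assms by (auto simp: move_def)
next
  case (Suc t)
  let ?i = "i + d * int (Suc t) * \<kappa> b" and ?j = "j + e * int (Suc t) * \<kappa> c"
  let ?x = "x \<noteq> odd (Suc t)" and ?y = "y \<noteq> odd (Suc t)"
  have nz: "d \<noteq> 0" "e \<noteq> 0" "- d \<in> {1, -1}" "- e \<in> {1, -1}"
    using assms(2,3) by auto
  have "f (move b ?i ?x (- d)) = move c ?j ?y (- e)"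
    using conjunct1[OF Suc.IH] nz by (simp add: move_def algebra_simps)
  then have "f (move b ?i ?x (- (- d))) = move c ?j ?y (- (- e))"
    by (rule aut_opposite[OF conjunct2[OF Suc.IH] nz(3,4)])
  then have "f (vx b (i + d * int (Suc (Suc t)) * \<kappa> b) (x \<noteq> odd (Suc (Suc t))))
      = vx c (j + e * int (Suc (Suc t)) * \<kappa> c) (y \<noteq> odd (Suc (Suc t)))"
    using nz by (simp add: move_def algebra_simps)
  then show ?case
    using conjunct2[OF Suc.IH] by blast
qed

lemma aut_cycle:
  assumes "f (vx b i x) = vx c j y" "d \<in> {1, -1}"
  obtains e where "e \<in> {1, -1}"
    "f (vx b (i + d * int t * \<kappa> b) (x \<noteq> odd t)) = vx c (j + e * int t * \<kappa> c) (y \<noteq> odd t)"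
proof -
  obtain e where "e \<in> {1, -1}" "f (move b i x d) = move c j y e"
    using aut_straight[OF assms] by blast
  then show ?thesis
    using that aut_cycle_dir[OF assms] by blast
qed

text \<open>After \<open>n\<close> steps along its cycle a vertex returns to its index but,
  \<open>n\<close> being odd, in the other copy; the image does the same in either
  direction.\<close>

lemma fibre_odd:
  assumes "odd n"
  shows "fst (f (vx b i (\<not> x))) = fst (f (vx b i x))"
proof -
  obtain c j y where v: "f (vx b i x) = vx c j y"
    by (rule aut_image[OF f])
  obtain e where "f (vx b (i + 1 * int n * \<kappa> b) (x \<noteq> odd n)) = vx c (j + e * int n * \<kappa> c) (y \<noteq> odd n)"
    using aut_cycle[OF v, of 1 n] by blast
  moreover have "vx b (i + 1 * int n * \<kappa> b) (x \<noteq> odd n) = vx b i (\<not> x)"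
    "vx c (j + e * int n * \<kappa> c) (y \<noteq> odd n) = vx c j (\<not> y)"
    using assms by (auto simp: vx_eq)
  ultimately show ?thesis
    using v by (simp add: vx_def)
qed

text \<open>As \<open>k\<close> is even, the detour has odd length k + 3 and changes the copy.
  Leaving in both directions gives two expressions for the same image, and their difference is
  divisible by \<open>n\<close>. The hypotheses \<open>sq\<close> say that k^2 is not 1 or -1 modulo
  n/2.\<close>

lemma fibre_even_outer:
  assumes "even k" "even n" "n \<noteq> 4 * k"
    and sq: "\<not> int n dvd 2 * (int k ^ 2 - 1)" "\<not> int n dvd 2 * (int k ^ 2 + 1)"
  shows "fst (f (vx False i (\<not> x))) = fst (f (vx False i x))"
proof -
  obtain c j y where v: "f (vx False i x) = vx c j y"
    by (rule aut_image[OF f])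
  text \<open>The other copy of a vertex is reached by a detour along spoke, inner edge, spoke, and then
    \<open>k\<close> edges of the outer cycle. The detour may leave in both directions.\<close>
  have detour: "\<exists>e'\<in>{1, -1}. f (vx False i (\<not> x)) = vx c (j + e * \<kappa> (\<not> c) + e' * int k * \<kappa> c) (\<not> y)"
    if "d \<in> {1, -1}" "e \<in> {1, -1}" "f (move True i (\<not> x) d) = move (\<not> c) j (\<not> y) e" for d e
  proof -
    have nz: "d \<noteq> 0" "e \<noteq> 0" "- d \<in> {1, -1}"
      using that(1,2) by auto
    have "f (vx True (i + d * int k) x) = vx (\<not> c) (j + e * \<kappa> (\<not> c)) y"
      using that(3) nz by (simp add: move_def \<kappa>_def)
    then have "f (vx False (i + d * int k) (\<not> x)) = vx c (j + e * \<kappa> (\<not> c)) (\<not> y)"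
      using spokes[OF vx_mem, of True "i + d * int k" x] by (simp add: spoke_end_vx)
    then obtain e' where e': "e' \<in> {1, -1}"
      "f (vx False (i + d * int k + - d * int k * \<kappa> False) ((\<not> x) \<noteq> odd k))
        = vx c (j + e * \<kappa> (\<not> c) + e' * int k * \<kappa> c) ((\<not> y) \<noteq> odd k)"
      by (rule aut_cycle[OF _ nz(3)])
    have "i + d * int k + - d * int k * \<kappa> False = i"
      by (simp add: \<kappa>_def)
    then have "f (vx False i (\<not> x)) = vx c (j + e * \<kappa> (\<not> c) + e' * int k * \<kappa> c) (\<not> y)"
      using e'(2) assms(1) by (simp only: not_not simp_thms)
    then show ?thesis
      using e'(1) by blast
  qed
  have v': "f (vx True i (\<not> x)) = vx (\<not> c) j (\<not> y)"
    using spokes[OF vx_mem, of False i x] v by (simp add: spoke_end_vx)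
  obtain e where e: "e \<in> {1, -1}" "f (move True i (\<not> x) 1) = move (\<not> c) j (\<not> y) e"
    using aut_straight[OF v'] by blast
  then have e_neg: "f (move True i (\<not> x) (- 1)) = move (\<not> c) j (\<not> y) (- e)" "- e \<in> {1, -1}"
    using aut_opposite[OF v'] by auto
  obtain e1 where e1: "e1 \<in> {1, -1}"
      "f (vx False i (\<not> x)) = vx c (j + e * \<kappa> (\<not> c) + e1 * int k * \<kappa> c) (\<not> y)"
    using detour[OF insertI1 e] by blast
  obtain e2 where e2: "e2 \<in> {1, -1}"
      "f (vx False i (\<not> x)) = vx c (j + - e * \<kappa> (\<not> c) + e2 * int k * \<kappa> c) (\<not> y)"
    using detour[OF _ e_neg(2,1)] by blast
  have "vx c (j + e * \<kappa> (\<not> c) + e1 * int k * \<kappa> c) (\<not> y)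
      = vx c (j + - e * \<kappa> (\<not> c) + e2 * int k * \<kappa> c) (\<not> y)"
    using trans[OF e1(2)[symmetric] e2(2)] .
  then have "int n dvd (j + e * \<kappa> (\<not> c) + e1 * int k * \<kappa> c) - (j + - e * \<kappa> (\<not> c) + e2 * int k * \<kappa> c)"
    unfolding vx_eq by blast
  moreover have "(j + e * \<kappa> (\<not> c) + e1 * int k * \<kappa> c) - (j + - e * \<kappa> (\<not> c) + e2 * int k * \<kappa> c)
      = 2 * e * \<kappa> (\<not> c) + (e1 - e2) * int k * \<kappa> c"
    by (simp add: algebra_simps)
  ultimately have dvd: "int n dvd 2 * e * \<kappa> (\<not> c) + (e1 - e2) * int k * \<kappa> c"
    by (simp only:)
  \<comment> \<open>Otherwise \<open>n\<close> would divide twice a cycle step.\<close>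
  have "e1 \<noteq> e2"
    using dvd not_dvd_kappa(2)[of "\<not> c"] e(1) by auto
  then have "e2 = - e1"
    using e1(1) e2(1) by auto
  show ?thesis
  proof (cases c)
    \<comment> \<open>An image of inner type would force k^2 to be 1 or -1 modulo n/2.\<close>
    case True
    then have "2 * e * \<kappa> (\<not> c) + (e1 - e2) * int k * \<kappa> c = 2 * (e + e1 * int k ^ 2)"
      using \<open>e2 = - e1\<close> by (simp add: \<kappa>_def power2_eq_square)
    moreover have "\<not> int n dvd 2 * (e + e1 * int k ^ 2)"
    proof -
      have "2 * (1 - int k ^ 2) = - (2 * (int k ^ 2 - 1))" "2 * (- 1 - int k ^ 2) = - (2 * (int k ^ 2 + 1))"
        by simp_all
      then have "\<not> int n dvd 2 * (1 - int k ^ 2)" "\<not> int n dvd 2 * (- 1 - int k ^ 2)"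
        using sq by (simp_all only: dvd_minus_iff not_False_eq_True)
      then show ?thesis
        using sq e(1) e1(1) by (auto simp: add.commute)
    qed
    ultimately show ?thesis
      using dvd by simp
  next
    case False
    \<comment> \<open>For an image of outer type, \<open>e1 = - e\<close> brings the detour back to
      index \<open>j\<close>. Otherwise \<open>n\<close> divides 4k, and 0 < 4k < 2n leaves only n =
      4k.\<close>
    show ?thesis
    proof (cases "e1 = - e")
      case True
      then show ?thesis
        using e1(2) v False by (simp add: \<kappa>_def vx_def)
    next
      case False
      then have "e1 = e"
        using e(1) e1(1) by auto
      then have "int n dvd e * (4 * int k)"
        using dvd \<open>\<not> c\<close> \<open>e2 = - e1\<close> by (simp add: \<kappa>_def algebra_simps)
      then have "int n dvd 4 * int k"
        using e(1) by auto
      then have "4 * int k = int n"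
        using dvd_range[of "4 * int k"] k_pos k_less by auto
      then show ?thesis
        using assms(3) by linarith
    qed
  qed
qed

lemma fibre_even:
  assumes "even k" "even n" "n \<noteq> 4 * k"
    and sq: "\<not> int n dvd 2 * (int k ^ 2 - 1)" "\<not> int n dvd 2 * (int k ^ 2 + 1)"
  shows "fst (f (vx b i (\<not> x))) = fst (f (vx b i x))"
proof (cases b)
  case True
  have swap: "fst (f (vx True i y)) = fst (spoke_end (f (vx False i (\<not> y))))" for y
    using spokes[OF vx_mem, of False i "\<not> y"] by (simp add: spoke_end_vx)
  have "fst (spoke_end p) = fst (spoke_end q)" if "fst p = fst q" for p q
    using that by (simp add: spoke_end_def)
  then have "fst (f (vx True i (\<not> x))) = fst (f (vx True i (\<not> \<not> x)))"
    unfolding swap by (rule) (rule fibre_even_outer[OF assms])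
  then show ?thesis
    using True by simp
next
  case False
  then show ?thesis
    using fibre_even_outer[OF assms, of i x] by simp
qed

end

section \<open>Swapped copies singled out by walk lengths\<close>

lemma vx_shift_mod: "vx b (i + j mod int n) x = vx b (i + j) x"
  using dvd_minus_mod[of "int n" j] by (simp add: vx_eq dvd_diff_commute)

lemma nbhd_reach: "(\<lambda>(c, j). vx c (i + j) (\<not> y)) ` set (reach_nbrs n k p)
    = nbhd DV DE (case p of (c, j) \<Rightarrow> vx c (i + j) y)"
proof -
  obtain c j where p: "p = (c, j)"
    by force
  have "set (reach_nbrs n k p) = {(c, (j + \<kappa> c) mod int n), (c, (j - \<kappa> c) mod int n), (\<not> c, j)}"
    by (simp add: p \<kappa>_def Let_def)
  moreover have "nbhd DV DE (vx c (i + j) y)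
      = {vx c (i + (j + \<kappa> c)) (\<not> y), vx c (i + (j - \<kappa> c)) (\<not> y), vx (\<not> c) (i + j) (\<not> y)}"
    by (simp add: nbhd_vx move_def add.assoc add_diff_eq)
  ultimately show ?thesis
    by (simp only: p image_insert image_empty prod.case vx_shift_mod)
qed

lemma walk_ends_vx:
  "walk_ends DV DE l (vx b i x) = (\<lambda>(c, j). vx c (i + j) (x \<noteq> odd l)) ` set ((reach_step n k ^^ l) [(b, 0)])"
proof (induction l)
  case (Suc l)
  have "(\<lambda>(c, j). vx c (i + j) (\<not> y)) ` set (reach_step n k L)
      = (\<Union>p\<in>set L. nbhd DV DE (case p of (c, j) \<Rightarrow> vx c (i + j) y))" for L y
    unfolding nbhd_reach[symmetric] by (simp add: reach_step_def image_UN)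
  moreover have "(x \<noteq> odd (Suc l)) = (\<not> (x \<noteq> odd l))"
    by simp
  ultimately show ?case
    by (simp only: walk_ends.simps Suc.IH funpow.simps o_apply image_image UN_simps)
qed simp

text \<open>The ends \<open>?W\<close> of walks of length \<open>l\<close> or \<open>Suc l\<close>
  miss exactly the other copy of the start. Automorphisms preserve such sets, hence also the missed
  vertex.\<close>

lemma fibre_antipode:
  assumes f: "f \<in> aut DV DE" and "odd l"
    and far: "\<And>b. set ((reach_step n k ^^ l) [(b, 0)]) = UNIV \<times> {0..<int n} - {(b, 0)}"
    and near: "\<And>b. set ((reach_step n k ^^ Suc l) [(b, 0)]) = UNIV \<times> {0..<int n}"
  shows "fst (f (vx b i (\<not> x))) = fst (f (vx b i x))"
proof -
  let ?W = "\<lambda>p. walk_ends DV DE l p \<union> walk_ends DV DE (Suc l) p"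
  have W1: "walk_ends DV DE l (vx b i x) = (\<lambda>(c, j). vx c (i + j) (\<not> x)) ` (UNIV \<times> {0..<int n} - {(b, 0)})" for b i x
    unfolding walk_ends_vx far using \<open>odd l\<close> by simp
  have W2: "walk_ends DV DE (Suc l) (vx b i x) = (\<lambda>(c, j). vx c (i + j) x) ` (UNIV \<times> {0..<int n})" for b i x
    unfolding walk_ends_vx near using \<open>odd l\<close> by simp
  have out: "vx b i (\<not> x) \<notin> ?W (vx b i x)" for b i x
  proof -
    have zero: "j = 0" if "int n dvd j" "0 \<le> j" "j < int n" for j
      using not_dvd_small[of j] that by simp
    show ?thesis
      unfolding W1 W2 by (auto simp: vx_eq dest: zero)
  qed
  have "in": "q = vx b i (\<not> x)" if q: "q \<in> DV" "q \<notin> ?W (vx b i x)" for q b i x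
  proof -
    obtain c j y where q_eq: "q = vx c j y"
      using q(1) by (rule vx_cases)
    let ?d = "(j - i) mod int n"
    have d: "?d \<in> {0..<int n}" "q = vx c (i + ?d) y"
      using n_ge by (simp_all add: q_eq vx_shift_mod)
    have "y = (\<not> x)"
    proof (rule ccontr)
      assume "y \<noteq> (\<not> x)"
      then have "q \<in> walk_ends DV DE (Suc l) (vx b i x)"
        unfolding W2 using d by (auto intro!: image_eqI[of _ _ "(c, ?d)"])
      then show False
        using q(2) by blast
    qed
    moreover have "(c, ?d) = (b, 0)"
    proof (rule ccontr)
      assume "(c, ?d) \<noteq> (b, 0)"
      then have "q \<in> walk_ends DV DE l (vx b i x)"
        unfolding W1 using d \<open>y = (\<not> x)\<close> by (auto intro!: image_eqI[of _ _ "(c, ?d)"])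
      then show False
        using q(2) by blast
    qed
    ultimately show ?thesis
      using d(2) by simp
  qed
  obtain c j y where v: "f (vx b i x) = vx c j y"
    by (rule aut_image[OF f])
  have "?W (vx c j y) = f ` ?W (vx b i x)"
    unfolding v[symmetric] walk_ends_aut[OF f vx_mem] by blast
  moreover have "?W (vx b i x) \<subseteq> DV"
    by (intro Un_least walk_ends_subset vx_mem)
  then have "f (vx b i (\<not> x)) \<notin> f ` ?W (vx b i x)"
    using out[of b i x] inj_on_image_mem_iff[OF bij_betw_imp_inj_on[OF aut_bij[OF f]] vx_mem] by blast
  ultimately have "f (vx b i (\<not> x)) \<notin> ?W (vx c j y)"
    by (simp only: not_False_eq_True)
  then have "f (vx b i (\<not> x)) = vx c j (\<not> y)"
    by (rule "in"[OF aut_mem[OF f vx_mem]])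
  then show ?thesis
    using v by (simp add: vx_def)
qed

section \<open>Connectedness and the stable cases\<close>

lemma stable_from_fibres:
  assumes "connected_graph V E"
    and "\<And>f b i x. f \<in> aut DV DE \<Longrightarrow> fst (f (vx b i (\<not> x))) = fst (f (vx b i x))"
  shows "stable V E"
proof (rule stableI[OF assms(1)])
  show "V \<noteq> {}"
    using gv_mem by blast
  fix f v assume "f \<in> aut DV DE" "v \<in> V"
  moreover obtain b i where "v = gv b i"
    using \<open>v \<in> V\<close> by (rule gv_cases)
  ultimately show "fst (f (v, True)) = fst (f (v, False))"
    using assms(2)[of f b i False] by (simp add: vx_def)
qed

lemma equal_counts:
  assumes "count_outer n k = count_spoke n k" "count_inner n k = count_spoke n k"
  shows "(n, k) \<in> {(4, 1), (5, 2), (8, 3), (10, 2), (10, 3), (12, 5), (13, 5), (24, 5), (26, 5)}"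
proof -
  have "\<not> 26 < n"
    using count_large assms by blast
  then have "n \<in> set [3..<27]" "k \<in> set [1..<13]"
    unfolding set_upt atLeastLessThan_iff using n_ge k_pos k_less by linarith+
  then show ?thesis
    using count_small k_less assms by (simp only: Ball_def)
qed

lemma gp_connected: "connected_graph V E"
proof -
  let ?R = "(\<lambda>a b. a \<in> V \<and> b \<in> V \<and> E a b)\<^sup>*\<^sup>*"
  have edge: "?R u v" if "u \<in> V" "v \<in> V" "E u v" for u v
    using that by (intro r_into_rtranclp) simp
  have spoke: "?R (gv b i) (gv c i)" for b c i
  proof (cases "b = c")
    case False
    then show ?thesis
      by (intro edge gv_mem) (simp add: gv_adj)
  qed simp
  have up: "?R (gv False i) (gv False (i + int t))" for i t
  proof (induction t)
    case (Suc t)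
    moreover have "?R (gv False (i + int t)) (gv False (i + int (Suc t)))"
      by (intro edge gv_mem) (simp add: gv_adj \<kappa>_def)
    ultimately show ?case
      by (rule rtranclp_trans)
  qed simp
  have all: "?R (gv b i) (gv c j)" for b c i j
  proof -
    have "i + int (nat ((j - i) mod int n)) - j = - (j - i - (j - i) mod int n)"
      using n_ge by simp
    then have "int n dvd i + int (nat ((j - i) mod int n)) - j"
      by (simp only: dvd_minus_iff dvd_minus_mod)
    then have "gv False (i + int (nat ((j - i) mod int n))) = gv False j"
      by (simp add: gv_eq)
    then have "?R (gv False i) (gv False j)"
      using up[of i "nat ((j - i) mod int n)"] by simp
    then show ?thesis
      by (rule rtranclp_trans[OF rtranclp_trans[OF spoke] spoke])
  qed
  have "?R u v" if "u \<in> V" "v \<in> V" for u v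
    by (rule gv_cases[OF that(1)], rule gv_cases[OF that(2)]) (simp only: all)
  then show ?thesis
    by (simp add: connected_graph_def)
qed

lemma stable_antipodal:
  assumes "odd l" and reach: "\<forall>b\<in>set [False, True].
    set ((reach_step n k ^^ l) [(b, 0)]) = set (List.product [False, True] [0..int n - 1]) - {(b, 0)} \<and>
    set ((reach_step n k ^^ Suc l) [(b, 0)]) = set (List.product [False, True] [0..int n - 1])"
  shows "stable V E"
proof (rule stable_from_fibres[OF gp_connected])
  fix f b i x assume f: "f \<in> aut DV DE"
  have all: "set (List.product [False, True] [0..int n - 1]) = UNIV \<times> {0..<int n}"
    by auto
  have b: "b \<in> set [False, True]" for b
    by simp
  show "fst (f (vx b i (\<not> x))) = fst (f (vx b i x))"
    by (rule fibre_antipode[OF f \<open>odd l\<close>])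
      (rule conjunct1[OF bspec[OF reach[unfolded all] b]] conjunct2[OF bspec[OF reach[unfolded all] b]])+
qed

lemma stable_odd:
  assumes "odd n"
  shows "stable V E"
proof (cases "count_outer n k = count_spoke n k \<and> count_inner n k = count_spoke n k")
  case True
  \<comment> \<open>These are the only pairs of the list with odd \<open>n\<close>.\<close>
  then have "(n = 5 \<and> k = 2) \<or> (n = 13 \<and> k = 5)"
    using equal_counts assms by auto
  then show ?thesis
  proof (elim disjE conjE)
    assume "n = 5" "k = 2"
    then show ?thesis
      using reach_5_2 by (intro stable_antipodal[of 3]) (simp, simp only:)
  next
    assume "n = 13" "k = 5"
    then show ?thesis
      using reach_13_5 by (intro stable_antipodal[of 5]) (simp, simp only:)
  qed
next
  case False
  show ?thesis
  proof (rule stable_from_fibres[OF gp_connected])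
    fix f b i x assume f: "f \<in> aut DV DE"
    show "fst (f (vx b i (\<not> x))) = fst (f (vx b i x))"
      by (rule fibre_odd[OF f spokes_preserved[OF f False] assms])
  qed
qed

lemma stable_even:
  assumes "even n" "even k" "n \<noteq> 4 * k"
    and "\<not> int n dvd 2 * (int k ^ 2 - 1)" "\<not> int n dvd 2 * (int k ^ 2 + 1)"
  shows "stable V E"
proof -
  \<comment> \<open>The only listed pair with both entries even is (10, 2), and there n = 2(k^2 +
    1), which the last hypothesis excludes.\<close>
  have neq: "\<not> (count_outer n k = count_spoke n k \<and> count_inner n k = count_spoke n k)"
    using equal_counts assms by auto
  show ?thesis
  proof (rule stable_from_fibres[OF gp_connected])
    fix f b i x assume f: "f \<in> aut DV DE"
    show "fst (f (vx b i (\<not> x))) = fst (f (vx b i x))"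
      by (rule fibre_even[OF f spokes_preserved[OF f neq] assms(2,1,3-5)])
  qed
qed

section \<open>Unstable cases\<close>

lemma DE_sym: "DE p q \<Longrightarrow> DE q p"
  by (auto simp: dc_E_def gp_E_def)

lemma finite_DV: "finite DV"
proof -
  have "V = UNIV \<times> {..<n}"
    by (auto simp: gp_V_def)
  then show ?thesis
    by (simp add: dc_V_def)
qed

text \<open>Explicit automorphisms are given by a formula \<open>g\<close> on integer indices.
  Spokes and forward cycle arcs suffice: backward arcs follow by symmetry, and finiteness supplies
  the converse.\<close>

lemma dc_autE:
  assumes cong: "\<And>b i j x. int n dvd i - j \<Longrightarrow> g b i x = g b j x"
    and mem: "\<And>b i x. g b i x \<in> DV"
    and inj: "\<And>b i x c j y. g b i x = g c j y \<Longrightarrow> vx b i x = vx c j y"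
    and spoke: "\<And>b i x. DE (g b i x) (g (\<not> b) i (\<not> x))"
    and cycle: "\<And>b i x. DE (g b i x) (g b (i + \<kappa> b) (\<not> x))"
  obtains f where "f \<in> aut DV DE" "\<And>b i x. f (vx b i x) = g b i x"
proof -
  define f where "f p = (if p \<in> DV then g (fst (fst p)) (int (snd (fst p))) (snd p) else p)" for p
  have f_vx: "f (vx b i x) = g b i x" for b i x
  proof -
    have "int n dvd i mod int n - i"
      using dvd_minus_mod[of "int n" i] by (simp only: dvd_diff_commute)
    then show ?thesis
      using n_ge cong[of "i mod int n" i b x] vx_mem[of b i x] by (simp add: f_def vx_def gv_def)
  qed
  have step: "DE (f (vx b i x)) (f (move b i x d))" if "d \<in> {0, 1, -1}" for b i x d
  proof -
    have "DE (g b i x) (g b (i - \<kappa> b) (\<not> x))"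
      using DE_sym[OF cycle[of b "i - \<kappa> b" "\<not> x"]] by simp
    then show ?thesis
      using that spoke[of b i x] cycle[of b i x] by (auto simp: move_def f_vx)
  qed
  have "f \<in> aut DV DE"
  proof (rule finite_hom_in_aut[OF finite_DV])
    show "inj_on f DV"
    proof (rule inj_onI)
      fix p q assume "p \<in> DV" "q \<in> DV" and eq: "f p = f q"
      obtain b i x where p: "p = vx b i x"
        by (rule vx_cases[OF \<open>p \<in> DV\<close>])
      obtain c j y where q: "q = vx c j y"
        by (rule vx_cases[OF \<open>q \<in> DV\<close>])
      show "p = q"
        using eq unfolding p q f_vx by (rule inj)
    qed
    show "f p \<in> DV" if "p \<in> DV" for p
      using mem that by (simp add: f_def)
    show "f p = p" if "p \<notin> DV" for p
      using that by (simp add: f_def)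
    show "DE (f p) (f q)" if "p \<in> DV" "q \<in> DV" "DE p q" for p q
    proof -
      obtain b i x where p: "p = vx b i x"
        by (rule vx_cases[OF \<open>p \<in> DV\<close>])
      have "q \<in> nbhd DV DE p"
        using that by (simp add: nbhd_def)
      then obtain d where "d \<in> {0, 1, -1}" "q = move b i x d"
        unfolding p nbhd_vx by blast
      then show ?thesis
        using step p by simp
    qed
  qed
  then show ?thesis
    using that f_vx by blast
qed

lemma not_stableI:
  assumes "f \<in> aut DV DE" "fst (f (vx b i True)) \<noteq> fst (f (vx b i False))"
  shows "\<not> stable V E"
  using stableD[OF _ assms(1) gv_mem, of b i] assms(2) by (auto simp: vx_def)

text \<open>Vertices with \<open>x = (odd i \<noteq> b)\<close> form an outer cycle together with the attached inner
vertices; the automorphism rotates the other vertices only.\<close>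
lemma unstable_shift:
  assumes "even n" "even t" "\<not> int n dvd t" and k: "odd k \<or> n = 4 * k \<and> t = 2 * int k"
  shows "\<not> stable V E"
proof -
  define g where "g b i x = vx b (if x = (odd i \<noteq> b) then i else i + t) x" for b i x
  have par: "odd i = odd j" if "int n dvd i - j" for i j
  proof -
    have "2 dvd i - j"
      using that \<open>even n\<close> by (meson dvd_trans even_of_nat)
    then show ?thesis
      by simp
  qed
  obtain f where f: "f \<in> aut DV DE" "\<And>b i x. f (vx b i x) = g b i x"
  proof (rule dc_autE[of g])
    show "g b i x = g b j x" if "int n dvd i - j" for b i j x
      unfolding g_def par[OF that] using that by (auto simp: vx_eq)
    show "g b i x \<in> DV" for b i x
      by (simp add: g_def vx_mem)
    show "vx b i x = vx c j y" if eq: "g b i x = g c j y" for b i x c j y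
    proof -
      have *: "b = c" "x = y"
        using eq by (auto simp: g_def vx_eq)
      have "odd i = odd j"
        using par eq \<open>even t\<close> by (fastforce simp: g_def vx_eq split: if_splits)
      then show ?thesis
        using eq * by (cases c) (auto simp: g_def vx_eq split: if_splits)
    qed
    show "DE (g b i x) (g (\<not> b) i (\<not> x))" for b i x
      by (auto simp: g_def vx_adj)
    show "DE (g b i x) (g b (i + \<kappa> b) (\<not> x))" for b i x
    proof (cases "b \<and> even k")
      case True
      \<comment> \<open>Here an inner edge joins a rotated to an unrotated vertex; rotating by 2k
        turns the step k into 3k or -k, which modulo 4k is again an inner step.\<close>
      then have nk: "int n = 4 * int k" "t = 2 * int k"
        using k by auto
      show ?thesis
        using True by (auto simp: g_def vx_adj \<kappa>_def nk)
    next
      case False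
      then have "odd (\<kappa> b)"
        by (auto simp: \<kappa>_def)
      then show ?thesis
        by (auto simp: g_def vx_adj)
    qed
  qed blast
  \<comment> \<open>Of the two copies of the outer vertex 0, only the one with
    \<open>x = True\<close> is moved.\<close>
  have "gv False (0 + t) \<noteq> gv False 0"
    using assms(3) by (simp add: gv_eq)
  then show ?thesis
    by (intro not_stableI[OF f(1), of False 0]) (simp add: f(2) g_def, simp add: vx_def)
qed

text \<open>Multiplication by \<open>k\<close> exchanges outer and inner cycles, but k^2 is
  \<open>s\<close> only modulo \<open>m\<close>, and an even \<open>k\<close> is not invertible
  modulo \<open>n\<close>. Adding the odd number \<open>m\<close> on one parity class repairs both
  defects. The class is unchanged along spokes and outer edges and switches along inner edges, where
  k^2 plus or minus \<open>m\<close> is \<open>s\<close> modulo \<open>n\<close>.\<close>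

lemma unstable_square:
  assumes "n = 2 * m" "even k" "s = 1 \<or> s = -1" and dvd: "int m dvd int k ^ 2 - s"
  shows "\<not> stable V E"
proof -
  have "odd (int k ^ 2 - s)"
    using assms(2,3) by auto
  then have "odd m"
    using dvd by (meson dvd_trans even_of_nat)
  have double: "int n dvd a" if "int m dvd a" "even a" for a
  proof -
    have "coprime 2 (int m)"
      using \<open>odd m\<close> by simp
    then show ?thesis
      using that assms(1) by (simp add: divides_mult)
  qed
  have half: "even a" "int m dvd a" if "int n dvd a" for a
    using that assms(1) by (auto elim!: dvdE)
  define g where "g b i x = vx (\<not> b) (int k * i + (if odd i \<noteq> (x \<noteq> b) then int m else 0)) (\<not> x)" for b i x
  have sq: "int n dvd int k ^ 2 - s + int m" "int n dvd int k ^ 2 - s - int m"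
    using dvd \<open>odd (int k ^ 2 - s)\<close> \<open>odd m\<close> by (auto intro!: double)
  obtain f where f: "f \<in> aut DV DE" "\<And>b i x. f (vx b i x) = g b i x"
  proof (rule dc_autE[of g])
    show "g b i x = g b j x" if "int n dvd i - j" for b i j x
    proof -
      have "odd i = odd j"
        using half(1)[OF that] by simp
      moreover have "int n dvd int k * i - int k * j"
        using that by (simp flip: right_diff_distrib)
      ultimately show ?thesis
        by (simp add: g_def vx_eq)
    qed
    show "g b i x \<in> DV" for b i x
      by (simp add: g_def vx_mem)
    show "vx b i x = vx c j y" if eq: "g b i x = g c j y" for b i x c j y
    proof -
      have *: "b = c" "x = y"
        using eq by (auto simp: g_def vx_eq)
      let ?e = "\<lambda>i. if odd i \<noteq> (x \<noteq> b) then int m else 0"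
      have d: "int n dvd (int k * i + ?e i) - (int k * j + ?e j)"
        using eq * by (simp add: g_def vx_eq)
      \<comment> \<open>As k times an index is even and \<open>m\<close> is odd, the parity of the
        image index tells whether \<open>m\<close> was added.\<close>
      have "odd i = odd j"
        using half(1)[OF d] \<open>odd m\<close> \<open>even k\<close> by (auto split: if_splits)
      then have "int n dvd int k * (i - j)"
        using d by (simp add: right_diff_distrib)
      then have "int m dvd int k * (i - j)"
        by (rule half)
      moreover have "coprime (int m) (int k)"
      proof (rule coprimeI)
        fix c assume "c dvd int m" "c dvd int k"
        then have "c dvd int k ^ 2" "c dvd int k ^ 2 - s"
          using dvd_trans[OF _ dvd] by (simp_all add: power2_eq_square)
        then have "c dvd int k ^ 2 - (int k ^ 2 - s)"
          by (rule dvd_diff)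
        then show "is_unit c"
          using assms(3) by auto
      qed
      ultimately have "int m dvd i - j"
        by (simp add: coprime_dvd_mult_right_iff)
      then have "int n dvd i - j"
        using \<open>odd i = odd j\<close> by (intro double) auto
      then show ?thesis
        using * by (simp add: vx_eq)
    qed
    show "DE (g b i x) (g (\<not> b) i (\<not> x))" for b i x
      by (auto simp: g_def vx_adj)
    show "DE (g b i x) (g b (i + \<kappa> b) (\<not> x))" for b i x
    proof (cases b)
      case False
      then show ?thesis
        by (auto simp: g_def vx_adj \<kappa>_def algebra_simps)
    next
      case True
      then show ?thesis
        using sq assms(2,3) by (auto simp: g_def vx_adj \<kappa>_def algebra_simps power2_eq_square)
    qed
  qed blast
  have "\<not> int n dvd int m"
    using half(1)[of "int m"] \<open>odd m\<close> by auto
  then have "gv True (int m) \<noteq> gv True 0"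
    by (simp add: gv_eq)
  then show ?thesis
    by (intro not_stableI[OF f(1), of False 0]) (simp add: f(2) g_def, simp add: vx_def)
qed

section \<open>Vertex determination and bipartiteness\<close>

text \<open>Within one type the spoke neighbour determines the index. Across types, both cycle
  neighbours of one vertex would be the single spoke neighbour of the other.\<close>

lemma gp_vertex_determining: "vertex_determining V E"
proof -
  have "gv b i = gv c j" if "nbhd V E (gv b i) = nbhd V E (gv c j)" for b c i j
  proof -
    have adj: "E (gv c j) w" if "E (gv b i) w" "w \<in> V" for w
      using that \<open>nbhd V E (gv b i) = nbhd V E (gv c j)\<close> by (auto simp: nbhd_def)
    show ?thesis
    proof (cases "b = c")
      case True
      then show ?thesis
        using adj[OF _ gv_mem, of "\<not> b" i] by (simp add: gv_adj gv_eq dvd_diff_commute)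
    next
      case False
      then have "int n dvd j - (i + \<kappa> b)" "int n dvd j - (i - \<kappa> b)"
        using adj[OF _ gv_mem, of b "i + \<kappa> b"] adj[OF _ gv_mem, of b "i - \<kappa> b"] by (auto simp: gv_adj)
      then have "int n dvd (j - (i - \<kappa> b)) - (j - (i + \<kappa> b))"
        using dvd_diff by blast
      moreover have "(j - (i - \<kappa> b)) - (j - (i + \<kappa> b)) = 2 * \<kappa> b"
        by simp
      ultimately show ?thesis
        using not_dvd_kappa(2) by simp
    qed
  qed
  then show ?thesis
    unfolding vertex_determining_def by (metis gv_cases)
qed

lemma gp_bipartite:
  assumes "even n" "odd k"
  shows "bipartite V E"
proof -
  define A where "A = {gv b i | b i. odd i \<noteq> b}"
  have A: "gv b i \<in> A \<longleftrightarrow> odd i \<noteq> b" for b i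
  proof -
    have "odd i = odd j" if "int n dvd i - j" for j
    proof -
      have "2 dvd i - j"
        using that \<open>even n\<close> by (meson dvd_trans even_of_nat)
      then show ?thesis
        by simp
    qed
    then show ?thesis
      by (auto simp: A_def gv_eq)
  qed
  have "u \<in> A \<longleftrightarrow> v \<notin> A" if uv: "u \<in> V" "v \<in> V" "E u v" for u v
  proof -
    obtain b i where u: "u = gv b i"
      by (rule gv_cases[OF uv(1)])
    obtain c j where v: "v = gv c j"
      by (rule gv_cases[OF uv(2)])
    have even: "even a" if "int n dvd a" for a
      using that \<open>even n\<close> by (meson dvd_trans even_of_nat)
    have "odd (\<kappa> b)"
      using assms(2) by (simp add: \<kappa>_def)
    then show ?thesis
      using uv(3) unfolding u v A gv_adj by (auto split: if_splits dest!: even)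
  qed
  moreover have "A \<subseteq> V"
    by (auto simp: A_def gv_mem)
  ultimately show ?thesis
    unfolding bipartite_def by blast
qed

text \<open>A spoke, an inner edge, a spoke and \<open>k\<close> outer edges form a closed walk of
  odd length k + 3.\<close>

lemma gp_not_bipartite:
  assumes "even k"
  shows "\<not> bipartite V E"
proof
  assume "bipartite V E"
  then obtain A where "\<forall>u\<in>V. \<forall>v\<in>V. E u v \<longrightarrow> (u \<in> A \<longleftrightarrow> v \<notin> A)"
    by (auto simp: bipartite_def)
  then have A: "gv b i \<in> A \<longleftrightarrow> gv c j \<notin> A" if "E (gv b i) (gv c j)" for b i c j
    using that gv_mem by blast
  have outer: "gv False (int t) \<in> A \<longleftrightarrow> (gv False 0 \<in> A) = even t" for t
  proof (induction t)
    case (Suc t)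
    have "E (gv False (int t)) (gv False (int (Suc t)))"
      by (simp add: gv_adj \<kappa>_def)
    then show ?case
      using Suc A by auto
  qed simp
  have "E (gv False 0) (gv True 0)" "E (gv True 0) (gv True (int k))" "E (gv True (int k)) (gv False (int k))"
    by (simp_all add: gv_adj \<kappa>_def)
  then show False
    using A outer[of k] assms by blast
qed

end

theorem theorem1p2:
  fixes n k :: nat
  assumes "1 \<le> k" and "2 * k < n"
  shows "(odd n \<longrightarrow> stable (gp_V n) (gp_E n k))
    \<and> (trivially_unstable (gp_V n) (gp_E n k) \<longleftrightarrow> even n \<and> odd k)
    \<and> (even n \<and> even k \<longrightarrow>
         (nontrivially_unstable (gp_V n) (gp_E n k) \<longleftrightarrow>
            [k^2 = 1] (mod (n div 2)) \<or> [k^2 + 1 = 0] (mod (n div 2)) \<or> n = 4 * k))"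
proof -
  interpret petersen n k
    by standard (rule assms)+
  have unstable_bip: "\<not> stable V E" if "even n" "odd k"
    using that not_dvd_kappa(2)[of False] by (intro unstable_shift[of 2]) (auto simp: \<kappa>_def)
  have even: "\<not> stable V E \<longleftrightarrow> [k^2 = 1] (mod (n div 2)) \<or> [k^2 + 1 = 0] (mod (n div 2)) \<or> n = 4 * k"
    if "even n" "even k"
  proof -
    obtain m where m: "n = 2 * m"
      using \<open>even n\<close> by blast
    have "[k^2 = 1] (mod (n div 2)) \<longleftrightarrow> [int (k^2) = int 1] (mod int m)"
      unfolding cong_int_iff by (simp add: m)
    then have c1: "[k^2 = 1] (mod (n div 2)) \<longleftrightarrow> int m dvd int k ^ 2 - 1"
      by (simp add: cong_iff_dvd_diff)
    have "[k^2 + 1 = 0] (mod (n div 2)) \<longleftrightarrow> [int (k^2 + 1) = int 0] (mod int m)"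
      unfolding cong_int_iff by (simp add: m)
    then have c2: "[k^2 + 1 = 0] (mod (n div 2)) \<longleftrightarrow> int m dvd int k ^ 2 + 1"
      by (simp add: cong_iff_dvd_diff add.commute)
    have nm: "int n = 2 * int m"
      by (simp add: m)
    have "\<not> stable V E" if "n = 4 * k"
      using that \<open>even n\<close> k_pos not_dvd_small[of "2 * int k"] by (intro unstable_shift[of "2 * int k"]) auto
    moreover have "\<not> stable V E" if "int m dvd int k ^ 2 - 1"
      using unstable_square[OF m \<open>even k\<close>, of 1] that by simp
    moreover have "\<not> stable V E" if "int m dvd int k ^ 2 + 1"
      using unstable_square[OF m \<open>even k\<close>, of "-1"] that by simp
    moreover have "stable V E" if "n \<noteq> 4 * k" "\<not> int m dvd int k ^ 2 - 1" "\<not> int m dvd int k ^ 2 + 1"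
    proof (rule stable_even[OF \<open>even n\<close> \<open>even k\<close> that(1)])
      show "\<not> int n dvd 2 * (int k ^ 2 - 1)" "\<not> int n dvd 2 * (int k ^ 2 + 1)"
        using that(2,3) unfolding nm by (simp_all only: dvd_mult_cancel_left) simp_all
    qed
    ultimately show ?thesis
      unfolding c1 c2 by blast
  qed
  \<comment> \<open>All these graphs are connected and vertex-determining, so an unstable one is
    trivially unstable exactly when it is bipartite.\<close>
  show ?thesis
    using stable_odd unstable_bip even gp_connected gp_vertex_determining gp_bipartite gp_not_bipartite
    unfolding trivially_unstable_def nontrivially_unstable_def unstable_def by blast
qed

end
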